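(* Let $n\ge 2$ be an integer and let $Q_{4n}=\langle a,b : a^{2n}=1,\ a^n=b^2,\ bab^{-1}=a^{-1}\rangle$ be the generalized quaternion group. Then \[ \mathrm{OSCom}(Q_{4n})\cong\begin{cases}K_{4n}, & \text{if } n \text{ is even},\\ K_2\vee(K_{2n}\sqcup K_{2n-2}), & \text{if } n \text{ is odd}.\end{cases} \]
   Context: For a finite group $G$, the order super commuting graph $\mathrm{OSCom}(G)$ is the simple graph with vertex set $G$ in which two distinct vertices $g,h$ are adjacent if and only if either $g$ and $h$ have the same order, or there exist $g',h'\in G$ such that $g'$ has the same order as $g$, $h'$ has the same order as $h$, and $g'h'=h'g'$. $K_r$ is the complete graph on $r$ vertices, $\sqcup$ is disjoint union of graphs, and $\vee$ is the join of graphs (disjoint union together with all edges between the two vertex sets). *)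

theory Defs
  imports "HOL-Algebra.Algebra" "Graph_Theory.Graph_Theory"
begin

text \<open>
  Words over generators of type \<open>'g\<close>: the letter \<open>(x, True)\<close> is the generator \<open>x\<close>, the letter
  \<open>(x, False)\<close> its formal inverse.
\<close>

type_synonym 'g word = "('g \<times> bool) list"

text \<open>
  \<open>pres_eq R\<close> is the smallest congruence on words that contains the defining relations \<open>R\<close>
  (pairs \<open>(l, r)\<close>, read as \<open>l = r\<close>) and free cancellation. Its classes form the group
  presented by \<open>R\<close>, with all elements of \<open>'g\<close> as generators.
\<close>

inductive pres_eq :: "('g word \<times> 'g word) set \<Rightarrow> 'g word \<Rightarrow> 'g word \<Rightarrow> bool"
  for R :: "('g word \<times> 'g word) set" where
  pres_rel: "(l, r) \<in> R \<Longrightarrow> pres_eq R l r"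
| pres_cancel: "pres_eq R [(x, s), (x, \<not> s)] []"
| pres_refl: "pres_eq R u u"
| pres_sym: "pres_eq R u v \<Longrightarrow> pres_eq R v u"
| pres_trans: "pres_eq R u v \<Longrightarrow> pres_eq R v w \<Longrightarrow> pres_eq R u w"
| pres_append: "pres_eq R u u' \<Longrightarrow> pres_eq R v v' \<Longrightarrow> pres_eq R (u @ v) (u' @ v')"

definition pres_class :: "('g word \<times> 'g word) set \<Rightarrow> 'g word \<Rightarrow> 'g word set" where
  "pres_class R u = {v. pres_eq R u v}"

definition presented_group :: "('g word \<times> 'g word) set \<Rightarrow> 'g word set monoid" where
  "presented_group R =
    \<lparr>carrier = range (pres_class R),
     monoid.mult = (\<lambda>C D. \<Union>u\<in>C. \<Union>v\<in>D. pres_class R (u @ v)),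
     one = pres_class R []\<rparr>"

lemma pres_class_eq_iff: "pres_class R u = pres_class R v \<longleftrightarrow> pres_eq R u v"
proof
  assume "pres_class R u = pres_class R v"
  then show "pres_eq R u v"
    using pres_refl[of R v] unfolding pres_class_def by blast
next
  assume uv: "pres_eq R u v"
  show "pres_class R u = pres_class R v"
    unfolding pres_class_def using pres_trans[OF uv] pres_trans[OF pres_sym[OF uv]] by blast
qed

lemma presented_group_mult:
  "pres_class R u \<otimes>\<^bsub>presented_group R\<^esub> pres_class R v = pres_class R (u @ v)"
proof -
  have "pres_class R (u' @ v') = pres_class R (u @ v)"
    if "u' \<in> pres_class R u" "v' \<in> pres_class R v" for u' v'
  proof -
    have "pres_eq R u u'" "pres_eq R v v'"
      using that by (simp_all add: pres_class_def)
    then have "pres_eq R (u @ v) (u' @ v')" by (rule pres_append)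
    then show ?thesis by (simp only: pres_class_eq_iff pres_sym)
  qed
  moreover have "u \<in> pres_class R u" "v \<in> pres_class R v"
    by (simp_all add: pres_class_def pres_refl)
  ultimately have "(\<Union>u'\<in>pres_class R u. \<Union>v'\<in>pres_class R v. pres_class R (u' @ v')) =
      pres_class R (u @ v)"
    by blast
  then show ?thesis by (simp add: presented_group_def)
qed

lemma pres_eq_inverse: "pres_eq R (rev (map (\<lambda>(x, s). (x, \<not> s)) u) @ u) []"
proof (induction u)
  case Nil
  show ?case by (simp add: pres_refl)
next
  case (Cons y u)
  obtain x s where y: "y = (x, s)" by fastforce
  let ?v = "rev (map (\<lambda>(x, s). (x, \<not> s)) u)"
  have "pres_eq R ([(x, \<not> s), (x, s)] @ u) ([] @ u)"
    using pres_cancel[of R x "\<not> s"] by (intro pres_append) (auto intro: pres_refl)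
  then have "pres_eq R (?v @ [(x, \<not> s), (x, s)] @ u) (?v @ u)"
    by (intro pres_append) (simp_all add: pres_refl)
  from pres_trans[OF this] Cons.IH show ?case by (simp add: y)
qed

lemma group_presented_group: "group (presented_group R)"
proof (rule groupI)
  fix C D E
  assume "C \<in> carrier (presented_group R)" "D \<in> carrier (presented_group R)"
    "E \<in> carrier (presented_group R)"
  then obtain u v w where "C = pres_class R u" "D = pres_class R v" "E = pres_class R w"
    by (auto simp: presented_group_def)
  then show "C \<otimes>\<^bsub>presented_group R\<^esub> D \<otimes>\<^bsub>presented_group R\<^esub> E =
      C \<otimes>\<^bsub>presented_group R\<^esub> (D \<otimes>\<^bsub>presented_group R\<^esub> E)"
    by (simp add: presented_group_mult)
next
  fix C D
  assume "C \<in> carrier (presented_group R)" "D \<in> carrier (presented_group R)"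
  then obtain u v where "C = pres_class R u" "D = pres_class R v"
    by (auto simp: presented_group_def)
  then show "C \<otimes>\<^bsub>presented_group R\<^esub> D \<in> carrier (presented_group R)"
    by (simp add: presented_group_mult) (simp add: presented_group_def)
next
  show "\<one>\<^bsub>presented_group R\<^esub> \<in> carrier (presented_group R)"
    by (simp add: presented_group_def)
next
  have one_eq: "\<one>\<^bsub>presented_group R\<^esub> = pres_class R []"
    by (simp add: presented_group_def)
  fix C
  assume "C \<in> carrier (presented_group R)"
  then obtain u where C: "C = pres_class R u"
    by (auto simp: presented_group_def)
  show "\<one>\<^bsub>presented_group R\<^esub> \<otimes>\<^bsub>presented_group R\<^esub> C = C"
    by (simp add: C one_eq presented_group_mult)
  let ?D = "pres_class R (rev (map (\<lambda>(x, s). (x, \<not> s)) u))"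
  have "?D \<otimes>\<^bsub>presented_group R\<^esub> C = \<one>\<^bsub>presented_group R\<^esub>"
    unfolding C one_eq presented_group_mult pres_class_eq_iff by (rule pres_eq_inverse)
  moreover have "?D \<in> carrier (presented_group R)"
    by (simp add: presented_group_def)
  ultimately show "\<exists>D \<in> carrier (presented_group R).
      D \<otimes>\<^bsub>presented_group R\<^esub> C = \<one>\<^bsub>presented_group R\<^esub>"
    by blast
qed

datatype quat_gen = Gen_a | Gen_b

definition quaternion_relations :: "nat \<Rightarrow> (quat_gen word \<times> quat_gen word) set" where
  "quaternion_relations n =
    {(replicate (2 * n) (Gen_a, True), []),
     (replicate n (Gen_a, True), [(Gen_b, True), (Gen_b, True)]),
     ([(Gen_b, True), (Gen_a, True), (Gen_b, False)], [(Gen_a, False)])}"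

text \<open>The index is \<open>n\<close>, not the order: \<open>generalized_quaternion n\<close> is $Q_{4n}$.\<close>

definition generalized_quaternion :: "nat \<Rightarrow> quat_gen word set monoid" where
  "generalized_quaternion n = presented_group (quaternion_relations n)"

text \<open>
  Simple graphs are loopless symmetric digraphs without parallel arcs, i.e. instances of
  \<^locale>\<open>pair_graph\<close>: an edge between \<open>u\<close> and \<open>v\<close> is the pair of arcs \<open>(u, v)\<close>, \<open>(v, u)\<close>.
\<close>

definition OSCom :: "('a, 'b) monoid_scheme \<Rightarrow> 'a pair_pre_digraph" where
  "OSCom G =
    \<lparr>pverts = carrier G,
     parcs = {(g, h). g \<in> carrier G \<and> h \<in> carrier G \<and> g \<noteq> h \<and>
       (group.ord G g = group.ord G h \<or>
        (\<exists>g' \<in> carrier G. \<exists>h' \<in> carrier G.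
           group.ord G g' = group.ord G g \<and> group.ord G h' = group.ord G h \<and>
           g' \<otimes>\<^bsub>G\<^esub> h' = h' \<otimes>\<^bsub>G\<^esub> g'))}\<rparr>"

definition complete_graph :: "nat \<Rightarrow> nat pair_pre_digraph" where
  "complete_graph r = \<lparr>pverts = {..<r}, parcs = {(u, v). u < r \<and> v < r \<and> u \<noteq> v}\<rparr>"

definition graph_disjoint_union ::
    "'a pair_pre_digraph \<Rightarrow> 'b pair_pre_digraph \<Rightarrow> ('a + 'b) pair_pre_digraph" where
  "graph_disjoint_union G H =
    \<lparr>pverts = pverts G <+> pverts H,
     parcs = {(Inl u, Inl v) |u v. (u, v) \<in> parcs G} \<union> {(Inr u, Inr v) |u v. (u, v) \<in> parcs H}\<rparr>"

definition graph_join ::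
    "'a pair_pre_digraph \<Rightarrow> 'b pair_pre_digraph \<Rightarrow> ('a + 'b) pair_pre_digraph" where
  "graph_join G H =
    \<lparr>pverts = pverts G <+> pverts H,
     parcs = parcs (graph_disjoint_union G H) \<union>
       {(Inl u, Inr v) |u v. u \<in> pverts G \<and> v \<in> pverts H} \<union>
       {(Inr v, Inl u) |u v. u \<in> pverts G \<and> v \<in> pverts H}\<rparr>"

lemma pair_graphI:
  assumes "finite (pverts G)" "parcs G \<subseteq> pverts G \<times> pverts G" "sym (parcs G)" "irrefl (parcs G)"
  shows "pair_graph G"
proof -
  have "finite (parcs G)"
    using assms(1,2) by (meson finite_SigmaI finite_subset)
  then show ?thesis
    using assms by unfold_locales (auto simp: symmetric_def irrefl_def)
qed

lemma pair_graphD: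
  assumes "pair_graph G"
  shows "finite (pverts G)" "parcs G \<subseteq> pverts G \<times> pverts G" "sym (parcs G)" "irrefl (parcs G)"
proof -
  interpret pair_graph G by fact
  show "finite (pverts G)" by (rule pair_finite_verts)
  show "parcs G \<subseteq> pverts G \<times> pverts G" by (auto dest: in_arcsD1 in_arcsD2)
  show "sym (parcs G)" using pair_sym_arcs by (simp add: symmetric_def)
  show "irrefl (parcs G)" by (rule irreflI) (use pair_no_loops in fastforce)
qed

lemma pair_graph_OSCom:
  assumes "finite (carrier G)"
  shows "pair_graph (OSCom G)"
proof (rule pair_graphI)
  show "sym (parcs (OSCom G))"
    by (rule symI) (simp add: OSCom_def, metis)
qed (use assms in \<open>auto simp: OSCom_def irrefl_def\<close>)

lemma complete_digraph_complete_graph: "complete_digraph r (with_proj (complete_graph r))"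
  unfolding complete_digraph_pair_def by (simp add: complete_graph_def)

lemma pair_graph_disjoint_union:
  assumes "pair_graph G" "pair_graph H"
  shows "pair_graph (graph_disjoint_union G H)"
proof (rule pair_graphI)
  note GH = pair_graphD[OF assms(1)] pair_graphD[OF assms(2)]
  show "finite (pverts (graph_disjoint_union G H))"
    using GH by (simp add: graph_disjoint_union_def)
  show "parcs (graph_disjoint_union G H) \<subseteq>
      pverts (graph_disjoint_union G H) \<times> pverts (graph_disjoint_union G H)"
    using GH(2,6) by (auto simp: graph_disjoint_union_def)
  show "sym (parcs (graph_disjoint_union G H))"
    using GH(3,7) by (auto simp: graph_disjoint_union_def intro!: symI dest: symD)
  show "irrefl (parcs (graph_disjoint_union G H))"
    using GH(4,8) by (auto simp: graph_disjoint_union_def irrefl_def)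
qed

lemma pair_graph_join:
  assumes "pair_graph G" "pair_graph H"
  shows "pair_graph (graph_join G H)"
proof (rule pair_graphI)
  note U = pair_graphD[OF pair_graph_disjoint_union[OF assms]]
  have verts: "pverts (graph_join G H) = pverts (graph_disjoint_union G H)"
    by (simp add: graph_join_def graph_disjoint_union_def)
  show "finite (pverts (graph_join G H))"
    using U(1) by (simp add: verts)
  show "parcs (graph_join G H) \<subseteq> pverts (graph_join G H) \<times> pverts (graph_join G H)"
    using U(2) unfolding verts by (auto simp: graph_join_def) (auto simp: graph_disjoint_union_def)
  show "sym (parcs (graph_join G H))"
    using U(3) by (auto simp: graph_join_def intro!: symI dest: symD)
  show "irrefl (parcs (graph_join G H))"
    using U(4) by (auto simp: graph_join_def irrefl_def)
qed

end

theory Submission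
  imports Defs
begin

text \<open>
  Every element of \<open>Q = generalized_quaternion n\<close> is \<open>a^i\<close> or \<open>a^i b\<close>. Since \<open>b\<close> inverts \<open>a\<close>, the
  square of \<open>a^i b\<close> is \<open>b^2 = a^n\<close>, the unique involution; so all \<open>2n\<close> elements outside the cyclic
  subgroup \<open>\<langle>a\<rangle>\<close> of order \<open>2n\<close> have order 4. The graph depends only on which orders occur in
  commuting pairs, and the parity of \<open>n\<close> decides whether \<open>\<langle>a\<rangle>\<close> contains an element of order 4.

  If \<open>n\<close> is even, then \<open>a^(n/2)\<close> has order 4. Hence every order is realised inside the abelian group
  \<open>\<langle>a\<rangle>\<close>, and any two vertices are adjacent (\<open>OSCom_even\<close>).

  If \<open>n\<close> is odd, then 4 does not divide \<open>2n\<close>, so the elements of order 4 are exactly the \<open>a^i b\<close>. Such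
  an element commutes with \<open>a^j\<close> only if \<open>a^j = a^(-j)\<close>, that is, if \<open>a^j\<close> is one of the two elements of order
  at most 2. These two are central and give the \<open>K_2\<close> of the join; the \<open>2n\<close> elements of order 4 and
  the remaining \<open>2n - 2\<close> powers of \<open>a\<close> are cliques with no edge between them (\<open>OSCom_odd\<close>).

  For the group given by generators and relations, the existence of the normal forms is a short
  rewriting argument. Their distinctness is where a presentation could collapse; it is excluded by
  letting \<open>Q\<close> act on pairs of complex numbers through its faithful two-dimensional representation
  (\<open>quaternion_group_generalized_quaternion\<close>).
\<close>

section \<open>Isomorphisms onto complete graphs and joins of complete graphs\<close>

lemma digraph_iso_with_projI:
  assumes f: "bij_betw f (pverts G) (pverts H)"
    and G: "parcs G \<subseteq> pverts G \<times> pverts G"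
    and H: "parcs H \<subseteq> pverts H \<times> pverts H"
    and arcs: "\<And>u v. u \<in> pverts G \<Longrightarrow> v \<in> pverts G \<Longrightarrow>
      (u, v) \<in> parcs G \<longleftrightarrow> (f u, f v) \<in> parcs H"
  shows "digraph_iso (with_proj G) (with_proj H)"
proof -
  let ?h = "\<lparr>iso_verts = f, iso_arcs = map_prod f f, iso_head = snd, iso_tail = fst\<rparr>"
  have inj: "inj_on f (pverts G)" and img: "f ` pverts G = pverts H"
    using f by (auto simp: bij_betw_def)
  have "inj_on (map_prod f f) (parcs G)"
    using map_prod_inj_on[OF inj inj] G by (rule inj_on_subset)
  moreover have "wf_digraph (with_proj G)"
    by unfold_locales (use G in auto)
  ultimately have "pre_digraph.digraph_isomorphism (with_proj G) ?h"
    using inj by (simp add: pre_digraph.digraph_isomorphism_def)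
  moreover have "map_prod f f ` parcs G = parcs H"
  proof
    show "map_prod f f ` parcs G \<subseteq> parcs H"
      using G arcs by auto
    show "parcs H \<subseteq> map_prod f f ` parcs G"
    proof
      fix e assume e: "e \<in> parcs H"
      then have "e \<in> f ` pverts G \<times> f ` pverts G" using H img by auto
      then obtain u v where uv: "e = (f u, f v)" "u \<in> pverts G" "v \<in> pverts G" by auto
      then have "(u, v) \<in> parcs G" using arcs e by simp
      then show "e \<in> map_prod f f ` parcs G" using uv by (auto intro: rev_image_eqI)
    qed
  qed
  then have "with_proj H = app_iso ?h (with_proj G)"
    using img by (simp add: app_iso_def with_proj_def)
  ultimately show ?thesis
    unfolding digraph_iso_def by blast
qed

lemma digraph_iso_complete_graphI:
  assumes "finite (pverts G)" "card (pverts G) = r"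
    and "parcs G = {(u, v). u \<in> pverts G \<and> v \<in> pverts G \<and> u \<noteq> v}"
  shows "digraph_iso (with_proj G) (with_proj (complete_graph r))"
proof -
  obtain f where f: "bij_betw f (pverts G) {..<r}"
    using assms(1,2) by (metis bij_betw_iff_card finite_lessThan card_lessThan)
  have "f u < r" if "u \<in> pverts G" for u
    using f that by (auto simp: bij_betw_def)
  moreover have "f u = f v \<longleftrightarrow> u = v" if "u \<in> pverts G" "v \<in> pverts G" for u v
    using f that by (auto simp: bij_betw_def dest: inj_onD)
  ultimately show ?thesis
    using f assms(3)
    by (intro digraph_iso_with_projI[where f = f]) (auto simp: complete_graph_def)
qed

text \<open>
  The join of \<open>K_c\<close> with a disjoint union of two cliques is the complete graph on three parts from which
  the edges between two of the parts are removed; in this form it can be read off without naming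
  an isomorphism.
\<close>

lemma digraph_iso_join_complete_graphsI:
  assumes V: "pverts G = C \<union> A \<union> B"
    and disj: "C \<inter> A = {}" "C \<inter> B = {}" "A \<inter> B = {}"
    and fin: "finite C" "finite A" "finite B"
    and card: "card C = c" "card A = x" "card B = y"
    and arcs: "\<And>u v. (u, v) \<in> parcs G \<longleftrightarrow> u \<in> pverts G \<and> v \<in> pverts G \<and> u \<noteq> v \<and>
      \<not> (u \<in> A \<and> v \<in> B) \<and> \<not> (u \<in> B \<and> v \<in> A)"
  shows "digraph_iso (with_proj G)
    (with_proj (graph_join (complete_graph c)
      (graph_disjoint_union (complete_graph x) (complete_graph y))))"
proof -
  have bij: "\<exists>h. bij_betw h S {..<k}" if "finite S" "card S = k" for S :: "'a set" and k :: nat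
    using ex_bij_betw_finite_nat[OF that(1)] that(2) by (simp add: lessThan_atLeast0)
  obtain p q r where p: "bij_betw p C {..<c}" and q: "bij_betw q A {..<x}"
    and r: "bij_betw r B {..<y}"
    using bij[OF fin(1) card(1)] bij[OF fin(2) card(2)] bij[OF fin(3) card(3)] by blast
  define f where "f u = (if u \<in> C then Inl (p u) else if u \<in> A then Inr (Inl (q u))
    else Inr (Inr (r u)))" for u
  have fC: "f u = Inl (p u)" if "u \<in> C" for u using that by (simp add: f_def)
  have fA: "f u = Inr (Inl (q u))" if "u \<in> A" for u using that disj by (auto simp: f_def)
  have fB: "f u = Inr (Inr (r u))" if "u \<in> B" for u using that disj by (auto simp: f_def)
  note lt = bij_betwE[OF p] bij_betwE[OF q] bij_betwE[OF r]
  have eq: "p u = p v \<longleftrightarrow> u = v" if "u \<in> C" "v \<in> C" for u v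
    using p that by (auto simp: bij_betw_def dest: inj_onD)
  have eq': "q u = q v \<longleftrightarrow> u = v" if "u \<in> A" "v \<in> A" for u v
    using q that by (auto simp: bij_betw_def dest: inj_onD)
  have eq'': "r u = r v \<longleftrightarrow> u = v" if "u \<in> B" "v \<in> B" for u v
    using r that by (auto simp: bij_betw_def dest: inj_onD)
  let ?H = "graph_join (complete_graph c) (graph_disjoint_union (complete_graph x) (complete_graph y))"
  have vH: "pverts ?H = (Inl ` {..<c}) \<union> Inr ` (Inl ` {..<x} \<union> Inr ` {..<y})"
    by (simp add: graph_join_def graph_disjoint_union_def complete_graph_def Plus_def)
  have "f ` C = Inl ` p ` C" "f ` A = Inr ` Inl ` q ` A" "f ` B = Inr ` Inr ` r ` B"
    by (simp_all add: fC fA fB image_image)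
  then have img: "f ` C = Inl ` {..<c}" "f ` A = Inr ` Inl ` {..<x}" "f ` B = Inr ` Inr ` {..<y}"
    using p q r by (simp_all only: bij_betw_imp_surj_on)
  show ?thesis
  proof (rule digraph_iso_with_projI[where f = f])
    have "inj_on f (C \<union> A \<union> B)"
      by (rule inj_onI) (auto simp: fC fA fB eq eq' eq'')
    then show "bij_betw f (pverts G) (pverts ?H)"
      unfolding bij_betw_def V vH by (simp add: image_Un img Un_assoc)
    show "parcs G \<subseteq> pverts G \<times> pverts G" using arcs by auto
    show "parcs ?H \<subseteq> pverts ?H \<times> pverts ?H"
      by (auto simp: graph_join_def graph_disjoint_union_def complete_graph_def)
    fix u v assume "u \<in> pverts G" "v \<in> pverts G"
    then show "(u, v) \<in> parcs G \<longleftrightarrow> (f u, f v) \<in> parcs ?H"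
      using lt disj unfolding arcs unfolding V
      by (auto simp: fC fA fB eq eq' eq'' graph_join_def graph_disjoint_union_def
          complete_graph_def)
  qed
qed

section \<open>Groups with the normal forms of the generalized quaternion group\<close>

text \<open>
  The only commutation rule of the quaternion group. It is stated for an arbitrary group because it
  serves both to derive the normal forms in the presented group and to compute with them afterwards.
\<close>

lemma (in group) inverting_mult_power:
  assumes a [simp]: "a \<in> carrier G" and b [simp]: "b \<in> carrier G"
    and b_a: "b \<otimes> a = inv a \<otimes> b"
  shows "b \<otimes> a [^] (i::int) = a [^] (- i) \<otimes> b"
proof -
  have nat: "b \<otimes> a [^] (k::nat) = a [^] (- int k) \<otimes> b" for k
  proof (induction k)
    case (Suc k)
    have "b \<otimes> a [^] Suc k = (b \<otimes> a [^] k) \<otimes> a"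
      by (simp add: m_assoc)
    also have "\<dots> = a [^] (- int k) \<otimes> (b \<otimes> a)"
      by (simp add: Suc m_assoc)
    also have "\<dots> = (a [^] (- int k) \<otimes> a [^] (- 1 :: int)) \<otimes> b"
      by (simp add: b_a m_assoc int_pow_neg)
    also have "\<dots> = a [^] (- int (Suc k)) \<otimes> b"
      by (simp add: minus_diff_commute flip: int_pow_mult)
    finally show ?case .
  qed simp
  show ?thesis
  proof (cases i rule: int_cases2)
    case (nonneg k)
    then show ?thesis using nat[of k] by (simp add: int_pow_int)
  next
    case (nonpos k)
    let ?c = "a [^] int k"
    have "b \<otimes> ?c = inv ?c \<otimes> b"
      using nat[of k] by (simp add: int_pow_int int_pow_neg)
    then have "?c \<otimes> b \<otimes> ?c = b"
      by (simp add: m_assoc) (simp flip: m_assoc)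
    then have "b \<otimes> inv ?c = ?c \<otimes> b"
      by (metis a b int_pow_closed inv_solve_right m_closed)
    then show ?thesis using nonpos by (simp add: int_pow_neg)
  qed
qed

text \<open>
  The facts about the presented group on which the graph depends. Exponents are integers
  because moving \<open>b\<close> past a power of \<open>a\<close> negates the exponent.
\<close>

locale quaternion_group = group G for G (structure) +
  fixes a b and n :: nat
  assumes n_pos: "n > 0"
    and a [simp]: "a \<in> carrier G" and b [simp]: "b \<in> carrier G"
    and ord_a: "ord a = 2 * n"
    and b_square: "b \<otimes> b = a [^] int n"
    and b_a: "b \<otimes> a = inv a \<otimes> b"
    and b_not_power: "b \<noteq> a [^] (i::int)"
    and carrier_eq: "carrier G = range (\<lambda>i::int. a [^] i) \<union> range (\<lambda>i::int. a [^] i \<otimes> b)"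
begin

lemmas b_power = inverting_mult_power[OF a b b_a]

lemma power_b_square: "(a [^] (i::int) \<otimes> b) \<otimes> (a [^] i \<otimes> b) = a [^] int n"
proof -
  have "(a [^] i \<otimes> b) \<otimes> (a [^] i \<otimes> b) = a [^] i \<otimes> (b \<otimes> a [^] i) \<otimes> b"
    by (simp add: m_assoc)
  also have "\<dots> = (a [^] i \<otimes> a [^] (- i)) \<otimes> (b \<otimes> b)"
    by (simp add: b_power m_assoc)
  also have "a [^] i \<otimes> a [^] (- i) = \<one>" by (simp add: int_pow_neg)
  finally show ?thesis by (simp add: b_square)
qed

lemma power_eq_iff: "a [^] (i::int) = a [^] (j::int) \<longleftrightarrow> 2 * int n dvd j - i"
  by (simp add: int_pow_eq ord_a)

lemma power_eq_one_iff: "a [^] (i::int) = \<one> \<longleftrightarrow> 2 * int n dvd i"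
  by (simp add: int_pow_eq_id ord_a)

lemma power_b_not_power: "a [^] (i::int) \<otimes> b \<noteq> a [^] (j::int)"
proof
  assume "a [^] i \<otimes> b = a [^] j"
  then have "b = inv (a [^] i) \<otimes> a [^] j"
    by (metis a b int_pow_closed inv_solve_left)
  then have "b = a [^] (j - i)"
    by (simp flip: int_pow_neg int_pow_mult)
  then show False using b_not_power by blast
qed

text \<open>
  All elements outside \<open>\<langle>a\<rangle>\<close> have the same square \<open>a^n\<close>, which has order 2; hence their order divides 4
  but not 2.
\<close>

lemma ord_power_b: "ord (a [^] (i::int) \<otimes> b) = 4"
proof -
  let ?x = "a [^] i \<otimes> b"
  have sq: "?x [^] (2::nat) = a [^] int n"
    using power_b_square[of i] by (simp add: numeral_2_eq_2)
  have "?x [^] (4::nat) = (?x [^] (2::nat)) [^] (2::nat)"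
    by (simp add: nat_pow_pow)
  also have "\<dots> = a [^] (2 * int n)"
    unfolding sq by (simp add: numeral_2_eq_2 flip: int_pow_mult)
  finally have "?x [^] (4::nat) = \<one>"
    by (simp add: power_eq_one_iff)
  then have dvd: "ord ?x dvd 4" by (simp add: pow_eq_id)
  then have "ord ?x \<in> {..4}" using dvd_imp_le by fastforce
  also have "{..4} = {0, 1, 2, 3, 4::nat}" by auto
  finally have "ord ?x \<in> {0, 1, 2, 3, 4}" .
  moreover have "\<not> ord ?x dvd 2"
    using n_pos zdvd_not_zless[of "int n" "2 * int n"]
    by (simp add: pow_eq_id[symmetric] sq power_eq_one_iff)
  ultimately show ?thesis using dvd by auto
qed

lemma card_powers: "card (range (\<lambda>i::int. a [^] i)) = 2 * n"
  and finite_powers: "finite (range (\<lambda>i::int. a [^] i))"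
proof -
  have "range (\<lambda>i::int. a [^] i) = (\<lambda>i. a [^] i) ` {0..<2 * int n}"
  proof -
    have "a [^] i \<in> (\<lambda>i. a [^] i) ` {0..<2 * int n}" for i :: int
      by (rule image_eqI[of _ _ "i mod (2 * int n)"])
        (use n_pos in \<open>auto simp: power_eq_iff mod_eq_dvd_iff[symmetric]\<close>)
    then show ?thesis by blast
  qed
  moreover have "inj_on (\<lambda>i. a [^] i) {0..<2 * int n}"
  proof (rule inj_onI)
    fix i j assume *: "i \<in> {0..<2 * int n}" "j \<in> {0..<2 * int n}" "a [^] i = a [^] j"
    then have "j mod (2 * int n) = i mod (2 * int n)"
      by (simp only: power_eq_iff mod_eq_dvd_iff)
    then show "i = j" using * by simp
  qed
  ultimately show "card (range (\<lambda>i::int. a [^] i)) = 2 * n" "finite (range (\<lambda>i::int. a [^] i))"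
    by (simp_all add: card_image)
qed

lemma card_powers_b: "card (range (\<lambda>i::int. a [^] i \<otimes> b)) = 2 * n"
  and finite_powers_b: "finite (range (\<lambda>i::int. a [^] i \<otimes> b))"
proof -
  have eq: "range (\<lambda>i::int. a [^] i \<otimes> b) = (\<lambda>x. x \<otimes> b) ` range (\<lambda>i::int. a [^] i)"
    by (simp add: image_image)
  have "inj_on (\<lambda>x. x \<otimes> b) (range (\<lambda>i::int. a [^] i))"
    by (rule inj_onI) auto
  then show "card (range (\<lambda>i::int. a [^] i \<otimes> b)) = 2 * n"
    unfolding eq by (simp add: card_image card_powers)
  show "finite (range (\<lambda>i::int. a [^] i \<otimes> b))"
    unfolding eq using finite_powers by simp
qed

lemma powers_disjoint: "range (\<lambda>i::int. a [^] i) \<inter> range (\<lambda>i::int. a [^] i \<otimes> b) = {}"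
  using power_b_not_power by (metis (no_types, lifting) disjoint_iff imageE)

lemma finite_carrier: "finite (carrier G)"
  by (simp add: carrier_eq finite_powers finite_powers_b)

lemma card_carrier: "card (carrier G) = 4 * n"
  unfolding carrier_eq
  by (simp add: card_Un_disjoint finite_powers finite_powers_b powers_disjoint card_powers card_powers_b)

lemma carrier_cases:
  assumes "g \<in> carrier G"
  obtains (power) i :: int where "g = a [^] i" | (power_b) i :: int where "g = a [^] i \<otimes> b"
  using assms unfolding carrier_eq by blast

lemma powers_commute: "a [^] (i::int) \<otimes> a [^] (j::int) = a [^] j \<otimes> a [^] i"
  by (simp add: add.commute flip: int_pow_mult)

lemma OSCom_arc_iff:
  "(u, v) \<in> parcs (OSCom G) \<longleftrightarrow> u \<in> carrier G \<and> v \<in> carrier G \<and> u \<noteq> v \<and>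
    (ord u = ord v \<or> (\<exists>g\<in>carrier G. \<exists>h\<in>carrier G. ord g = ord u \<and> ord h = ord v \<and> g \<otimes> h = h \<otimes> g))"
  by (simp add: OSCom_def)

text \<open>
  Because \<open>a^(n/2)\<close> has order 4, each vertex has the order of some power of \<open>a\<close>, and powers of \<open>a\<close> commute.
\<close>

lemma OSCom_even:
  assumes "even n"
  shows "digraph_iso (with_proj (OSCom G)) (with_proj (complete_graph (4 * n)))"
proof (rule digraph_iso_complete_graphI)
  have ex: "\<exists>i::int. ord (a [^] i) = ord g" if "g \<in> carrier G" for g
    using that
  proof (cases rule: carrier_cases)
    case (power_b i)
    have "ord (a [^] int (n div 2)) = 2 * n div (n div 2)"
      unfolding int_pow_int using assms n_pos
      by (subst ord_pow) (auto simp: ord_a elim!: evenE)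
    also have "\<dots> = 4" using assms n_pos by (auto elim!: evenE)
    finally show ?thesis using power_b ord_power_b by metis
  qed blast
  have "\<exists>g'\<in>carrier G. \<exists>h'\<in>carrier G. ord g' = ord g \<and> ord h' = ord h \<and> g' \<otimes> h' = h' \<otimes> g'"
    if "g \<in> carrier G" "h \<in> carrier G" for g h
    using ex[OF that(1)] ex[OF that(2)] powers_commute by (metis a int_pow_closed)
  then show "parcs (OSCom G) =
      {(u, v). u \<in> pverts (OSCom G) \<and> v \<in> pverts (OSCom G) \<and> u \<noteq> v}"
    by (auto simp: OSCom_def)
qed (simp_all add: OSCom_def finite_carrier card_carrier)

text \<open>
  Conjugation by \<open>b\<close> inverts \<open>a^j\<close>, hence fixes it when \<open>a^j\<close> is its own inverse.
\<close>

lemma power_central: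
  assumes "a [^] (j::int) \<otimes> a [^] j = \<one>" "g \<in> carrier G"
  shows "a [^] j \<otimes> g = g \<otimes> a [^] j"
  using assms(2)
proof (cases rule: carrier_cases)
  case (power i)
  then show ?thesis by (simp add: powers_commute)
next
  case (power_b i)
  have inv: "a [^] (- j) = a [^] j"
    using assms(1) by (simp add: int_pow_neg inv_equality)
  have "g \<otimes> a [^] j = a [^] i \<otimes> (b \<otimes> a [^] j)"
    using power_b by (simp add: m_assoc)
  also have "\<dots> = a [^] i \<otimes> a [^] j \<otimes> b"
    by (simp add: b_power inv m_assoc)
  finally show ?thesis using power_b powers_commute[of i j] by (simp add: m_assoc[symmetric])
qed

text \<open>
  Moving \<open>a^j\<close> to the left past \<open>b\<close> turns it into \<open>a^(-j)\<close>, so commuting forces \<open>a^(i-j) b = a^(i+j) b\<close>.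
\<close>

lemma power_commutes_power_bD:
  assumes "(a [^] (i::int) \<otimes> b) \<otimes> a [^] (j::int) = a [^] j \<otimes> (a [^] i \<otimes> b)"
  shows "a [^] j \<otimes> a [^] j = \<one>"
proof -
  have "a [^] (i - j) \<otimes> b = (a [^] i \<otimes> b) \<otimes> a [^] j"
    using int_pow_mult[of a i "- j"] by (simp add: m_assoc b_power)
  also have "\<dots> = a [^] (i + j) \<otimes> b"
    unfolding assms by (simp add: add.commute flip: m_assoc int_pow_mult)
  finally have "a [^] (i - j) = a [^] (i + j)" by simp
  then have "2 * int n dvd j + j" by (simp add: power_eq_iff)
  then show ?thesis by (simp add: power_eq_one_iff flip: int_pow_mult)
qed

lemma ord_dvd_2_iff: "g \<in> carrier G \<Longrightarrow> ord g dvd 2 \<longleftrightarrow> g \<otimes> g = \<one>"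
  by (simp add: pow_eq_id[symmetric] numeral_2_eq_2)

lemma elements_ord_dvd_2: "{g \<in> carrier G. ord g dvd 2} = {\<one>, a [^] int n}"
proof (intro equalityI subsetI)
  fix g assume g: "g \<in> {g \<in> carrier G. ord g dvd 2}"
  then have "g \<in> carrier G" by simp
  then show "g \<in> {\<one>, a [^] int n}"
  proof (cases rule: carrier_cases)
    case (power i)
    then have "2 * int n dvd i + i"
      using g by (simp add: ord_dvd_2_iff power_eq_one_iff flip: int_pow_mult)
    then have "int n dvd i" by simp
    then obtain k where k: "i = int n * k" by (elim dvdE)
    show ?thesis
    proof (cases "even k")
      case True
      then have "a [^] i = \<one>" by (auto simp: k power_eq_one_iff)
      then show ?thesis using power by simp
    next
      case False
      then obtain l where "k = 2 * l + 1" by (elim oddE)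
      then have "int n - i = 2 * int n * (- l)" by (simp add: k algebra_simps)
      then have "a [^] i = a [^] int n" unfolding power_eq_iff by simp
      then show ?thesis using power by simp
    qed
  next
    case (power_b i)
    then show ?thesis using g by (simp add: ord_power_b)
  qed
next
  have "a [^] int n \<otimes> a [^] int n = \<one>"
    by (simp add: power_eq_one_iff flip: int_pow_mult)
  then show "g \<in> {g \<in> carrier G. ord g dvd 2}" if "g \<in> {\<one>, a [^] int n}" for g
    using that by (auto simp: ord_dvd_2_iff)
qed

lemma power_n_neq_one: "a [^] int n \<noteq> \<one>"
  using n_pos zdvd_not_zless[of "int n" "2 * int n"] unfolding power_eq_one_iff by simp

text \<open>
  A power of \<open>a\<close> has order dividing \<open>2n\<close>, and 4 does not divide \<open>2n\<close> for odd \<open>n\<close>.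
\<close>

lemma ord_eq_4_iff:
  assumes "odd n" "g \<in> carrier G"
  shows "ord g = 4 \<longleftrightarrow> g \<in> range (\<lambda>i::int. a [^] i \<otimes> b)"
  using assms(2)
proof (cases rule: carrier_cases)
  case (power i)
  have "g [^] (2 * n) = a [^] (2 * int n * i)"
    using power by (simp add: int_pow_int[symmetric] int_pow_pow mult.commute)
  then have "g [^] (2 * n) = \<one>"
    by (simp add: power_eq_one_iff)
  then have "ord g dvd 2 * n"
    using assms(2) by (simp add: pow_eq_id)
  moreover have "\<not> 4 dvd 2 * n" using assms(1) by presburger
  ultimately show ?thesis using power power_b_not_power by (metis (no_types, lifting) imageE)
next
  case (power_b i)
  then show ?thesis by (auto simp: ord_power_b)
qed

text \<open>
  The three parts are cut out by orders alone, so membership is inherited by the representatives \<open>g, h\<close> of the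
  same orders in the definition of adjacency. This is why the commutation facts about single
  elements determine the edges.
\<close>

lemma OSCom_odd:
  assumes "odd n"
  shows "digraph_iso (with_proj (OSCom G))
    (with_proj (graph_join (complete_graph 2)
      (graph_disjoint_union (complete_graph (2 * n)) (complete_graph (2 * n - 2)))))"
proof -
  let ?C = "{g \<in> carrier G. ord g dvd 2}"
  let ?A = "{g \<in> carrier G. ord g = 4}"
  let ?B = "carrier G - ?C - ?A"
  have A: "?A = range (\<lambda>i::int. a [^] i \<otimes> b)"
    using ord_eq_4_iff[OF assms] by (auto simp: carrier_eq)
  have C: "card ?C = 2"
    unfolding elements_ord_dvd_2 using power_n_neq_one by simp
  have B: "card ?B = 2 * n - 2"
  proof -
    have "card ?B = card (carrier G) - card ?C - card ?A"
      by (subst card_Diff_subset card_Diff_subset; (use finite_carrier in auto)?)+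
    then show ?thesis unfolding C unfolding A by (simp add: card_carrier card_powers_b)
  qed
  have central: "g \<otimes> h = h \<otimes> g" if "g \<in> ?C" "h \<in> carrier G" for g h
  proof -
    have "g \<in> carrier G" using that by simp
    then show ?thesis
    proof (cases rule: carrier_cases)
      case (power i)
      then show ?thesis using that power_central[of i h] by (simp add: ord_dvd_2_iff)
    next
      case (power_b i)
      then show ?thesis using that by (simp add: ord_power_b)
    qed
  qed
  have no_commute: "ord h dvd 2 \<or> ord h = 4"
    if g_ord: "g \<in> ?A" and h: "h \<in> carrier G" and gh: "g \<otimes> h = h \<otimes> g" for g h
  proof -
    obtain i :: int where g: "g = a [^] i \<otimes> b" using g_ord unfolding A by blast
    from h show ?thesis
    proof (cases rule: carrier_cases)
      case (power j)
      then show ?thesis using h gh power_commutes_power_bD[of i j] by (simp add: g ord_dvd_2_iff)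
    next
      case (power_b j)
      then show ?thesis by (simp add: ord_power_b)
    qed
  qed
  have powers: "\<exists>i::int. g = a [^] i" if "g \<in> ?B" for g
    using that ord_power_b by (auto elim!: carrier_cases)
  have arcs: "(u, v) \<in> parcs (OSCom G) \<longleftrightarrow>
      u \<in> carrier G \<and> v \<in> carrier G \<and> u \<noteq> v \<and> \<not> (u \<in> ?A \<and> v \<in> ?B) \<and> \<not> (u \<in> ?B \<and> v \<in> ?A)"
    (is "_ \<longleftrightarrow> ?R") for u v
  proof
    assume "(u, v) \<in> parcs (OSCom G)"
    then consider (ord) "u \<in> carrier G" "v \<in> carrier G" "u \<noteq> v" "ord u = ord v"
      | (comm) g h where "u \<in> carrier G" "v \<in> carrier G" "u \<noteq> v" "g \<in> carrier G" "h \<in> carrier G"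
        "ord g = ord u" "ord h = ord v" "g \<otimes> h = h \<otimes> g"
      unfolding OSCom_arc_iff by blast
    then show ?R
    proof cases
      case ord
      then show ?thesis by auto
    next
      case comm
      then show ?thesis using no_commute[of g h] no_commute[of h g] by auto
    qed
  next
    assume R: ?R
    then have uv: "u \<in> carrier G" "v \<in> carrier G" "u \<noteq> v" by auto
    consider "u \<in> ?C" | "v \<in> ?C" | "u \<in> ?A" "v \<in> ?A" | "u \<in> ?B" "v \<in> ?B"
      using R by blast
    then have "ord u = ord v \<or> u \<otimes> v = v \<otimes> u"
    proof cases
      case 1 then show ?thesis using central uv by blast
    next
      case 2 then show ?thesis using central[of v u] uv by simp
    next
      case 3 then show ?thesis by simp
    next
      case 4
      obtain i j :: int where "u = a [^] i" "v = a [^] j"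
        using powers[OF 4(1)] powers[OF 4(2)] by blast
      then show ?thesis using powers_commute[of i j] by simp
    qed
    then show "(u, v) \<in> parcs (OSCom G)"
      using uv unfolding OSCom_arc_iff by blast
  qed
  have V: "pverts (OSCom G) = carrier G" by (simp add: OSCom_def)
  then have V': "pverts (OSCom G) = ?C \<union> ?A \<union> ?B" by blast
  have A_card: "card ?A = 2 * n" unfolding A by (rule card_powers_b)
  show ?thesis
  proof (rule digraph_iso_join_complete_graphsI[OF V' _ _ _ _ _ _ C A_card B])
    show "?C \<inter> ?A = {}" by auto
    show "?C \<inter> ?B = {}" "?A \<inter> ?B = {}" by blast+
    show "finite ?C" "finite ?A" "finite ?B" using finite_carrier by simp_all
    show "(u, v) \<in> parcs (OSCom G) \<longleftrightarrow> u \<in> pverts (OSCom G) \<and> v \<in> pverts (OSCom G) \<and>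
        u \<noteq> v \<and> \<not> (u \<in> ?A \<and> v \<in> ?B) \<and> \<not> (u \<in> ?B \<and> v \<in> ?A)" for u v
      unfolding V by (rule arcs)
  qed
qed

end

section \<open>Computing in a presented group\<close>

text \<open>
  The way to show that two words are different in a presented group: let the generators act by
  permutations satisfying the relations and compare the permutations induced by the words. The second argument
  gives the action of the formal inverses; it is a separate argument so that it can be given by a formula
  instead of an inverse function.
\<close>

definition word_action :: "('g \<Rightarrow> 'a \<Rightarrow> 'a) \<Rightarrow> ('g \<Rightarrow> 'a \<Rightarrow> 'a) \<Rightarrow> 'g word \<Rightarrow> 'a \<Rightarrow> 'a" where
  "word_action f f' u = foldr (\<lambda>(x, s) g. (if s then f x else f' x) \<circ> g) u id"

lemma word_action_simps [simp]:
  "word_action f f' [] = id"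
  "word_action f f' ((x, s) # u) = (if s then f x else f' x) \<circ> word_action f f' u"
  by (simp_all add: word_action_def)

lemma word_action_append: "word_action f f' (u @ v) = word_action f f' u \<circ> word_action f f' v"
  by (induction u) auto

lemma word_action_replicate: "word_action f f' (replicate k (x, True)) = f x ^^ k"
  by (induction k) auto

lemma pres_eq_word_action:
  assumes "pres_eq R u v"
    and "\<And>x. f x \<circ> f' x = id" "\<And>x. f' x \<circ> f x = id"
    and "\<And>l r. (l, r) \<in> R \<Longrightarrow> word_action f f' l = word_action f f' r"
  shows "word_action f f' u = word_action f f' v"
  using assms(1)
proof (induction rule: pres_eq.induct)
  case (pres_rel l r)
  then show ?case by (rule assms(4))
next
  case (pres_cancel x s)
  then show ?case by (cases s) (simp_all add: assms(2,3))
qed (simp_all add: word_action_append)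

lemma pres_class_carrier [simp]: "pres_class R u \<in> carrier (presented_group R)"
  by (simp add: presented_group_def)

lemma pres_class_Nil: "pres_class R [] = \<one>\<^bsub>presented_group R\<^esub>"
  by (simp add: presented_group_def)

lemma pres_class_Cons:
  "pres_class R (y # u) = pres_class R [y] \<otimes>\<^bsub>presented_group R\<^esub> pres_class R u"
  by (simp add: presented_group_mult)

lemma pres_class_inverse:
  "pres_class R [(x, False)] = inv\<^bsub>presented_group R\<^esub> pres_class R [(x, True)]"
proof -
  interpret group "presented_group R" by (rule group_presented_group)
  have "pres_eq R [(x, False), (x, True)] []"
    using pres_cancel[of R x False] by simp
  then show ?thesis
    by (intro inv_equality[symmetric])
      (simp_all add: presented_group_mult pres_class_eq_iff flip: pres_class_Nil)
qed

lemma pres_class_replicate: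
  "pres_class R (replicate k y) = pres_class R [y] [^]\<^bsub>presented_group R\<^esub> k"
proof -
  interpret group "presented_group R" by (rule group_presented_group)
  show ?thesis
  proof (induction k)
    case (Suc k)
    have "pres_class R (replicate (Suc k) y) = pres_class R (replicate k y @ [y])"
      by (simp add: replicate_append_same)
    then show ?case by (simp add: Suc flip: presented_group_mult)
  qed (simp add: pres_class_Nil)
qed

section \<open>Normal forms in the generalized quaternion group\<close>

text \<open>
  The matrices \<open>diag(z, 1/z)\<close> for \<open>a\<close> and \<open>((0, -1), (1, 0))\<close> for \<open>b\<close>, applied to vectors in \<open>\<complex>\<^sup>2\<close>. For a primitive
  \<open>2n\<close>-th root of unity \<open>z\<close> this is the standard faithful representation of the quaternion group.
\<close>

fun quat_gen_action :: "complex \<Rightarrow> quat_gen \<Rightarrow> complex \<times> complex \<Rightarrow> complex \<times> complex" where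
  "quat_gen_action z Gen_a (x, y) = (z * x, y / z)"
| "quat_gen_action z Gen_b (x, y) = (- y, x)"

fun quat_gen_action_inv :: "complex \<Rightarrow> quat_gen \<Rightarrow> complex \<times> complex \<Rightarrow> complex \<times> complex" where
  "quat_gen_action_inv z Gen_a (x, y) = (x / z, z * y)"
| "quat_gen_action_inv z Gen_b (x, y) = (y, - x)"

lemma quat_gen_action_a_pow: "(quat_gen_action z Gen_a ^^ k) (x, y) = (z ^ k * x, y / z ^ k)"
  by (induction k) (auto simp: mult.assoc)

text \<open>
  The condition \<open>z^n = -1\<close> is exactly the relation \<open>a^n = b^2\<close>, since \<open>b^2\<close> acts as \<open>-1\<close>.
\<close>

lemma quaternion_action_well_defined:
  assumes "z ^ n = - 1" "pres_eq (quaternion_relations n) u v"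
  shows "word_action (quat_gen_action z) (quat_gen_action_inv z) u =
    word_action (quat_gen_action z) (quat_gen_action_inv z) v"
  using assms(2)
proof (rule pres_eq_word_action)
  have n: "n > 0" using assms(1) by (cases n) auto
  with assms(1) have z: "z \<noteq> 0" by (auto simp: power_0_left)
  show "quat_gen_action z x \<circ> quat_gen_action_inv z x = id" for x
    using z by (cases x) (auto simp: fun_eq_iff)
  show "quat_gen_action_inv z x \<circ> quat_gen_action z x = id" for x
    using z by (cases x) (auto simp: fun_eq_iff)
  show "word_action (quat_gen_action z) (quat_gen_action_inv z) l =
      word_action (quat_gen_action z) (quat_gen_action_inv z) r"
    if "(l, r) \<in> quaternion_relations n" for l r
    using that z unfolding quaternion_relations_def
    by (auto simp: word_action_replicate fun_eq_iff quat_gen_action_a_pow power_mult assms(1)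
        power_even_eq mult.commute[of 2])
qed

lemma cis_pi_over_power_eq_1D:
  assumes "n > 0" "cis (pi / real n) ^ k = 1"
  shows "2 * n dvd k"
proof -
  have "cos (real k * (pi / real n)) = 1"
    using assms(2) by (simp add: DeMoivre complex_eq_iff)
  then obtain m :: int where "real k * (pi / real n) = of_int m * (2 * pi)"
    by (auto simp: cos_one_2pi_int)
  then have "real k = of_int m * (2 * real n)"
    using assms(1) by (simp add: field_simps)
  then have "real_of_int (int k) = real_of_int (2 * int n * m)" by simp
  then have "int k = 2 * int n * m" by (simp only: of_int_eq_iff)
  then have "int (2 * n) dvd int k" by simp
  then show ?thesis by (simp only: int_dvd_int_iff)
qed

text \<open>
  The vector \<open>(1, 0)\<close> separates what has to be separated: \<open>a^k\<close> sends it to \<open>(z^k, 0)\<close>, so \<open>a^k = 1\<close> forces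
  \<open>2n\<close> to divide \<open>k\<close>, while \<open>b\<close> sends it to \<open>(0, 1)\<close>, so \<open>b\<close> is not a power of \<open>a\<close>. That nothing else occurs in the
  group follows because the set of normal forms contains 1 and is stable under left multiplication by the four letters.
\<close>

lemma quaternion_group_generalized_quaternion:
  assumes "n > 0"
  shows "quaternion_group (generalized_quaternion n)
    (pres_class (quaternion_relations n) [(Gen_a, True)])
    (pres_class (quaternion_relations n) [(Gen_b, True)]) n"
proof -
  let ?R = "quaternion_relations n"
  let ?G = "presented_group ?R"
  interpret group ?G by (rule group_presented_group)
  let ?a = "pres_class ?R [(Gen_a, True)]"
  let ?b = "pres_class ?R [(Gen_b, True)]"
  let ?z = "cis (pi / real n)"
  let ?act = "word_action (quat_gen_action ?z) (quat_gen_action_inv ?z)"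
  have z: "?z ^ n = - 1"
    using assms by (simp add: DeMoivre)
  have act: "?act u = ?act v" if "pres_class ?R u = pres_class ?R v" for u v
    using quaternion_action_well_defined[OF z] that by (simp add: pres_class_eq_iff)
  have a_pow: "?a [^]\<^bsub>?G\<^esub> k = pres_class ?R (replicate k (Gen_a, True))" for k
    by (simp add: pres_class_replicate)
  have act_a: "?act (replicate k (Gen_a, True)) (1, 0) = (?z ^ k, 0)" for k
    by (simp add: word_action_replicate quat_gen_action_a_pow)
  have rel: "pres_class ?R l = pres_class ?R r" if "(l, r) \<in> ?R" for l r
    using pres_rel[OF that] by (simp add: pres_class_eq_iff)
  have a_2n: "?a [^]\<^bsub>?G\<^esub> (2 * n) = \<one>\<^bsub>?G\<^esub>"
    unfolding a_pow pres_class_Nil[symmetric] by (rule rel) (simp add: quaternion_relations_def)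
  have ord_a: "ord ?a = 2 * n"
  proof (rule dvd_antisym)
    show "ord ?a dvd 2 * n" using a_2n by (simp add: pow_eq_id)
    have "pres_class ?R (replicate (ord ?a) (Gen_a, True)) = pres_class ?R []"
      unfolding pres_class_Nil a_pow[symmetric] by simp
    then have "?z ^ ord ?a = 1"
      using act_a[of "ord ?a"] by (simp add: act)
    then show "2 * n dvd ord ?a" using assms by (rule cis_pi_over_power_eq_1D[rotated])
  qed
  have b_sq: "?b \<otimes>\<^bsub>?G\<^esub> ?b = ?a [^]\<^bsub>?G\<^esub> int n"
    unfolding int_pow_int a_pow presented_group_mult
    by (rule rel[symmetric]) (simp add: quaternion_relations_def)
  have b_a: "?b \<otimes>\<^bsub>?G\<^esub> ?a = inv\<^bsub>?G\<^esub> ?a \<otimes>\<^bsub>?G\<^esub> ?b"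
  proof -
    have "pres_class ?R [(Gen_b, True), (Gen_a, True), (Gen_b, False)] =
        pres_class ?R [(Gen_a, False)]"
      by (rule rel) (simp add: quaternion_relations_def)
    then have "?b \<otimes>\<^bsub>?G\<^esub> ?a \<otimes>\<^bsub>?G\<^esub> inv\<^bsub>?G\<^esub> ?b = inv\<^bsub>?G\<^esub> ?a"
      by (simp add: presented_group_mult flip: pres_class_inverse)
    then show ?thesis
      by (metis inv_closed inv_solve_right m_closed pres_class_carrier)
  qed
  have b_not: "?b \<noteq> ?a [^]\<^bsub>?G\<^esub> (i::int)" for i
  proof
    assume "?b = ?a [^]\<^bsub>?G\<^esub> i"
    \<comment> \<open>the exponent is reduced modulo the order so that the power is the class of a word in the letter \<open>a\<close> only\<close>
    also have "\<dots> = ?a [^]\<^bsub>?G\<^esub> int (nat (i mod (2 * int n)))"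
      using assms by (subst int_pow_eq) (auto simp: ord_a mod_eq_dvd_iff[symmetric])
    finally have "?b = pres_class ?R (replicate (nat (i mod (2 * int n))) (Gen_a, True))"
      unfolding int_pow_int a_pow .
    from fun_cong[OF act[OF this], of "(1, 0)"] show False
      unfolding act_a by simp
  qed
  let ?S = "range (\<lambda>i::int. ?a [^]\<^bsub>?G\<^esub> i) \<union> range (\<lambda>i::int. ?a [^]\<^bsub>?G\<^esub> i \<otimes>\<^bsub>?G\<^esub> ?b)"
  have a_S: "?a [^]\<^bsub>?G\<^esub> (j::int) \<otimes>\<^bsub>?G\<^esub> g \<in> ?S" if "g \<in> ?S" for g j
    using that by (auto simp flip: m_assoc int_pow_mult)
  have b_S: "?b \<otimes>\<^bsub>?G\<^esub> g \<in> ?S" if "g \<in> ?S" for g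
  proof -
    note bp = inverting_mult_power[OF pres_class_carrier pres_class_carrier b_a]
    have "?b \<otimes>\<^bsub>?G\<^esub> (?a [^]\<^bsub>?G\<^esub> i \<otimes>\<^bsub>?G\<^esub> ?b) = ?a [^]\<^bsub>?G\<^esub> (- i + int n)" for i :: int
    proof -
      have "?b \<otimes>\<^bsub>?G\<^esub> (?a [^]\<^bsub>?G\<^esub> i \<otimes>\<^bsub>?G\<^esub> ?b) = ?a [^]\<^bsub>?G\<^esub> (- i) \<otimes>\<^bsub>?G\<^esub> (?b \<otimes>\<^bsub>?G\<^esub> ?b)"
        using bp[of i] by (metis int_pow_closed m_assoc pres_class_carrier)
      then show ?thesis unfolding b_sq by (simp only: int_pow_mult pres_class_carrier)
    qed
    then show ?thesis using that bp by auto
  qed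
  have inv_b: "inv\<^bsub>?G\<^esub> ?b = ?a [^]\<^bsub>?G\<^esub> (- int n) \<otimes>\<^bsub>?G\<^esub> ?b"
  proof (rule inv_equality)
    have "?a [^]\<^bsub>?G\<^esub> (- int n) \<otimes>\<^bsub>?G\<^esub> ?b \<otimes>\<^bsub>?G\<^esub> ?b = ?a [^]\<^bsub>?G\<^esub> (- int n) \<otimes>\<^bsub>?G\<^esub> ?a [^]\<^bsub>?G\<^esub> int n"
      by (simp only: m_assoc int_pow_closed pres_class_carrier b_sq)
    then show "?a [^]\<^bsub>?G\<^esub> (- int n) \<otimes>\<^bsub>?G\<^esub> ?b \<otimes>\<^bsub>?G\<^esub> ?b = \<one>\<^bsub>?G\<^esub>"
      by (simp add: int_pow_neg)
  qed simp_all
  have letter_S: "pres_class ?R [y] \<otimes>\<^bsub>?G\<^esub> g \<in> ?S" if "g \<in> ?S" for y g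
  proof -
    have g: "g \<in> carrier ?G" using that by auto
    obtain x s where y: "y = (x, s)" by fastforce
    show ?thesis
    proof (cases x; cases s)
      assume "x = Gen_a" "s"
      then show ?thesis using a_S[OF that, of 1] y by simp
    next
      assume "x = Gen_a" "\<not> s"
      then show ?thesis using a_S[OF that, of "- 1"] y by (simp add: pres_class_inverse int_pow_neg)
    next
      assume "x = Gen_b" "s"
      then show ?thesis using b_S[OF that] y by simp
    next
      assume "x = Gen_b" "\<not> s"
      then have "pres_class ?R [y] \<otimes>\<^bsub>?G\<^esub> g = ?a [^]\<^bsub>?G\<^esub> (- int n) \<otimes>\<^bsub>?G\<^esub> (?b \<otimes>\<^bsub>?G\<^esub> g)"
        using y g by (simp only: pres_class_inverse inv_b m_assoc int_pow_closed pres_class_carrier)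
      then show ?thesis using a_S[OF b_S[OF that]] by simp
    qed
  qed
  have "pres_class ?R u \<in> ?S" for u
  proof (induction u)
    case Nil
    have "\<one>\<^bsub>?G\<^esub> = ?a [^]\<^bsub>?G\<^esub> (0::int)" by simp
    then show ?case unfolding pres_class_Nil by blast
  next
    case (Cons y u)
    then show ?case using letter_S pres_class_Cons by metis
  qed
  then have "carrier ?G \<subseteq> ?S" by (auto simp: presented_group_def)
  moreover have "?S \<subseteq> carrier ?G" by auto
  ultimately have carrier: "carrier ?G = ?S" by (rule equalityI)
  show ?thesis
    unfolding generalized_quaternion_def
    by unfold_locales (fact assms pres_class_carrier ord_a b_sq b_a b_not carrier)+
qed

section \<open>The order super commuting graph of the generalized quaternion group\<close>

theorem theorem2p11:
  fixes n :: nat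
  assumes "n \<ge> 2"
  shows "(even n \<longrightarrow>
            digraph_iso (with_proj (OSCom (generalized_quaternion n)))
              (with_proj (complete_graph (4 * n)))) \<and>
         (odd n \<longrightarrow>
            digraph_iso (with_proj (OSCom (generalized_quaternion n)))
              (with_proj (graph_join (complete_graph 2)
                (graph_disjoint_union (complete_graph (2 * n)) (complete_graph (2 * n - 2))))))"
proof -
  interpret quaternion_group "generalized_quaternion n"
    "pres_class (quaternion_relations n) [(Gen_a, True)]"
    "pres_class (quaternion_relations n) [(Gen_b, True)]" n
    using assms by (intro quaternion_group_generalized_quaternion) simp
  show ?thesis using OSCom_even OSCom_odd by blast
qed

end
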